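(* Let $\mu_*$ be the probability distribution on $[0,\infty)$ with c.d.f. $F_*$, where $1-F_*(y)=W(1)e^{-y}$ for $y\ge0$ and $1-F_*(y)=1$ for $y<0$. The invariant recursive tree process with marginal $\mu_*$ associated with the edge cover recursive distributional equation $$X\overset{D}{=}\min_{j\ge1}(\xi_j-X_j)^+$$ is endogenous.
   Context: $W$ is the inverse of $x\mapsto xe^x$ on $[0,\infty)$; $x^+=\max\{x,0\}$. In the equation, $X_1,X_2,\dots$ are i.i.d. copies of $X\ge0$, independent of the points $(\xi_j)_{j\ge1}$ of a rate 1 Poisson process on $[0,\infty)$; $\mu_*$ solves this equation. Let $\mathcal{V}$ be the set of finite words over $\mathbb{N}=\{1,2,\dots\}$, with empty word $\phi$, length $|\mathbf{i}|$, and concatenation $\mathbf{i}.j$. The invariant recursive tree process with marginal $\mu_*$ is a process $(X_{\mathbf{i}})_{\mathbf{i}\in\mathcal{V}}$ defined jointly with independent rate 1 Poisson processes $\xi^{\mathbf{i}}=(\xi^{\mathbf{i}}_1<\xi^{\mathbf{i}}_2<\cdots)$ on $[0,\infty)$, $\mathbf{i}\in\mathcal{V}$, such that: $X_{\mathbf{i}}=\min_{j\ge1}(\xi^{\mathbf{i}}_j-X_{\mathbf{i}.j})^+$ for all $\mathbf{i}\in\mathcal{V}$; each $X_{\mathbf{i}}$ has distribution $\mu_*$; and for each $d\ge0$ the variables $\{X_{\mathbf{i}}:|\mathbf{i}|=d\}$ are independent, and independent of $\{\xi^{\mathbf{i}'}:|\mathbf{i}'|<d\}$. The process is endogenous if the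 root variable $X_\phi$ is almost surely measurable with respect to the $\sigma$-algebra generated by $\{\xi^{\mathbf{i}}:\mathbf{i}\in\mathcal{V}\}$. *)

theory Defs
  imports "HOL-Probability.Probability"
begin

definition lambert_W :: "real \<Rightarrow> real" where
  "lambert_W = the_inv_into {0..} (\<lambda>x. x * exp x)"

definition attained_min :: "real \<Rightarrow> (nat \<Rightarrow> real) \<Rightarrow> bool" where
  "attained_min m a \<longleftrightarrow> (\<exists>j. m = a j) \<and> (\<forall>j. m \<le> a j)"

definition generated_sigma ::
    "'w measure \<Rightarrow> 'b measure \<Rightarrow> 'i set \<Rightarrow> ('i \<Rightarrow> 'w \<Rightarrow> 'b) \<Rightarrow> 'w measure" where
  "generated_sigma M N I Y =
     vimage_algebra (space M) (\<lambda>\<omega>. \<lambda>i\<in>I. Y i \<omega>) (\<Pi>\<^sub>M i\<in>I. N)"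

abbreviation real_seq :: "(nat \<Rightarrow> real) measure" where
  "real_seq \<equiv> \<Pi>\<^sub>M j\<in>UNIV. borel"

context prob_space
begin

(* T \<omega> lists the points of the configuration \<omega> in increasing order, the first one
   having index 0.  Divergence to infinity (local finiteness) makes the cardinality
   below the true number of points in B, since B is bounded. *)
definition poisson_process_rate1 :: "('a \<Rightarrow> nat \<Rightarrow> real) \<Rightarrow> bool" where
  "poisson_process_rate1 T \<longleftrightarrow>
     random_variable real_seq T \<and>
     (AE \<omega> in M. (\<forall>j. 0 \<le> T \<omega> j) \<and> strict_mono (T \<omega>) \<and> filterlim (T \<omega>) at_top sequentially) \<and>
     (\<forall>B k. B \<in> sets borel \<and> bounded B \<and> B \<subseteq> {0..} \<longrightarrow>
        prob {\<omega> \<in> space M. card {j. T \<omega> j \<in> B} = k} =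
          measure lborel B ^ k / fact k * exp (- measure lborel B)) \<and>
     (\<forall>B :: nat \<Rightarrow> real set.
        disjoint_family B \<and> (\<forall>n. B n \<in> sets borel \<and> bounded (B n) \<and> B n \<subseteq> {0..}) \<longrightarrow>
        indep_vars (\<lambda>_. count_space UNIV) (\<lambda>n \<omega>. card {j. T \<omega> j \<in> B n}) UNIV)"

(* Words over {1, 2, ...} are encoded as lists of naturals with all letters shifted
   down by one, matching the indexing of the points from 0; the word i.j is i @ [j]. *)
definition edge_cover_rtp ::
    "real measure \<Rightarrow> (nat list \<Rightarrow> 'a \<Rightarrow> nat \<Rightarrow> real) \<Rightarrow> (nat list \<Rightarrow> 'a \<Rightarrow> real) \<Rightarrow> bool" where
  "edge_cover_rtp \<mu> \<xi> X \<longleftrightarrow>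
     (\<forall>i. poisson_process_rate1 (\<xi> i)) \<and>
     indep_vars (\<lambda>_. real_seq) \<xi> UNIV \<and>
     (\<forall>i. random_variable borel (X i) \<and> distr M borel (X i) = \<mu>) \<and>
     (\<forall>i. AE \<omega> in M. attained_min (X i \<omega>) (\<lambda>j. max (\<xi> i \<omega> j - X (i @ [j]) \<omega>) 0)) \<and>
     (\<forall>d. indep_vars (\<lambda>_. borel) X {i. length i = d} \<and>
        indep_set
          (sets (generated_sigma M borel {i. length i = d} X))
          (sets (generated_sigma M real_seq {i. length i < d} \<xi>)))"

definition endogenous ::
    "(nat list \<Rightarrow> 'a \<Rightarrow> nat \<Rightarrow> real) \<Rightarrow> (nat list \<Rightarrow> 'a \<Rightarrow> real) \<Rightarrow> bool" where
  "endogenous \<xi> X \<longleftrightarrow>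
     (\<exists>Y \<in> borel_measurable (generated_sigma M real_seq UNIV \<xi>). AE \<omega> in M. X [] \<omega> = Y \<omega>)"

end

end

(*
  Cut the tree at depth d and put 0 at the leaves: this gives variables measurable with
  respect to the Poisson processes.  The recursion is antitone, so the cut variables of
  even depth lie below X and those of odd depth above.  Marking a Poisson process with
  i.i.d. variables of tail c exp(-s) shows that the recursion maps this tail to
  exp(-c) exp(-s).  Hence the cut variable at depth 2k has tail c_{2k} exp(-s), where
  c_0 = 0 and c_{d+1} = exp(-c_d), and c_{2k} tends to the fixed point W(1).  Variables
  below X whose tails converge to the tail of X have supremum X almost surely.
*)

theory Submission
  imports Defs
begin

section \<open>Poisson processes with independent marks\<close>

context prob_space
begin

text \<open>The generating function of the Poisson law of mean \<open>l\<close>, summed from the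
  exponential series.\<close>

lemma nn_integral_power_poisson:
  fixes N :: "'a \<Rightarrow> nat" and h l :: real
  assumes N [measurable]: "random_variable (count_space UNIV) N"
    and pN: "\<And>k. prob {\<omega> \<in> space M. N \<omega> = k} = l ^ k / fact k * exp (- l)"
    and "0 \<le> h" "0 \<le> l"
  shows "(\<integral>\<^sup>+\<omega>. ennreal (h ^ N \<omega>) \<partial>M) = ennreal (exp (- (l * (1 - h))))"
proof -
  define p where "p k = l ^ k / fact k * exp (- l)" for k
  have D: "distr M (count_space UNIV) N = density (count_space UNIV) (\<lambda>k. ennreal (p k))"
  proof (rule measure_eqI_countable[where A=UNIV])
    fix k :: nat
    have "emeasure (distr M (count_space UNIV) N) {k} = emeasure M {\<omega> \<in> space M. N \<omega> = k}"
      by (subst emeasure_distr) (auto intro!: arg_cong[where f="emeasure M"])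
    also have "\<dots> = ennreal (p k)"
      by (simp add: emeasure_eq_measure pN p_def)
    also have "\<dots> = emeasure (density (count_space UNIV) (\<lambda>k. ennreal (p k))) {k}"
      by (subst emeasure_density) (auto simp: nn_integral_count_space_indicator[symmetric])
    finally show "emeasure (distr M (count_space UNIV) N) {k}
      = emeasure (density (count_space UNIV) (\<lambda>k. ennreal (p k))) {k}" .
  qed auto
  have "(\<integral>\<^sup>+\<omega>. ennreal (h ^ N \<omega>) \<partial>M) = (\<integral>\<^sup>+k. ennreal (h ^ k) \<partial>distr M (count_space UNIV) N)"
    by (subst nn_integral_distr) auto
  also have "\<dots> = (\<integral>\<^sup>+k. ennreal (p k * h ^ k) \<partial>count_space UNIV)"
    unfolding D using assms
    by (subst nn_integral_density) (auto simp: p_def ennreal_mult'[symmetric] intro!: nn_integral_cong)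
  also have "\<dots> = (\<Sum>k. ennreal (p k * h ^ k))"
    by (rule nn_integral_count_space_nat)
  also have "\<dots> = ennreal (exp (- (l * (1 - h))))"
  proof (rule suminf_ennreal_eq)
    show "0 \<le> p k * h ^ k" for k using assms by (simp add: p_def)
    have "(\<lambda>k. (l * h) ^ k / fact k) sums exp (l * h)"
      using exp_converges[of "l * h"] by (simp add: field_simps)
    from sums_mult2[OF this, of "exp (- l)"]
    show "(\<lambda>k. p k * h ^ k) sums exp (- (l * (1 - h)))"
      by (simp add: p_def power_mult_distrib exp_add[symmetric] algebra_simps)
  qed
  finally show ?thesis .
qed

text \<open>Counts on disjoint sets are independent, so the expectation splits into Poisson
  generating functions. If \<open>h k\<close> is the chance that a mark is admissible in cell
  \<open>k\<close>, the integrand is the probability, given the points, that all marks in the first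
  \<open>K\<close> cells are admissible.\<close>

lemma poisson_counts_nn_integral:
  fixes B :: "nat \<Rightarrow> real set" and h :: "nat \<Rightarrow> real"
  assumes T: "poisson_process_rate1 T"
    and B: "disjoint_family B" "\<And>k. B k \<in> sets borel" "\<And>k. bounded (B k)" "\<And>k. B k \<subseteq> {0..}"
    and h: "\<And>k. 0 \<le> h k"
  shows "(\<integral>\<^sup>+\<omega>. (\<Prod>k<K. ennreal (h k ^ card {j. T \<omega> j \<in> B k})) \<partial>M)
    = ennreal (exp (- (\<Sum>k<K. measure lborel (B k) * (1 - h k))))"
proof -
  define N where "N k \<omega> = card {j. T \<omega> j \<in> B k}" for k \<omega>
  have ind: "indep_vars (\<lambda>_. count_space UNIV) N UNIV"
    using T B unfolding poisson_process_rate1_def N_def by blast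
  have N: "random_variable (count_space UNIV) (N k)" for k
    using ind by (auto simp: indep_vars_def)
  have "\<forall>B n. B \<in> sets borel \<and> bounded B \<and> B \<subseteq> {0..} \<longrightarrow>
      prob {\<omega> \<in> space M. card {j. T \<omega> j \<in> B} = n}
      = measure lborel B ^ n / fact n * exp (- measure lborel B)"
    using T unfolding poisson_process_rate1_def by (elim conjE)
  then have pN: "prob {\<omega> \<in> space M. N k \<omega> = n}
      = measure lborel (B k) ^ n / fact n * exp (- measure lborel (B k))" for k n
    unfolding N_def using B(2-4) by simp
  have ind': "indep_vars (\<lambda>_. borel) (\<lambda>k \<omega>. ennreal (h k ^ N k \<omega>)) {..<K}"
    by (rule indep_vars_compose2[OF indep_vars_subset[OF ind]]) auto
  have "(\<integral>\<^sup>+\<omega>. (\<Prod>k<K. ennreal (h k ^ N k \<omega>)) \<partial>M) = (\<Prod>k<K. \<integral>\<^sup>+\<omega>. ennreal (h k ^ N k \<omega>) \<partial>M)"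
    by (rule indep_vars_nn_integral) (use ind' in auto)
  also have "\<dots> = (\<Prod>k<K. ennreal (exp (- (measure lborel (B k) * (1 - h k)))))"
    by (intro prod.cong refl nn_integral_power_poisson N pN h measure_nonneg)
  also have "\<dots> = ennreal (exp (- (\<Sum>k<K. measure lborel (B k) * (1 - h k))))"
    by (simp add: prod_ennreal exp_sum sum_negf[symmetric])
  finally show ?thesis by (simp add: N_def)
qed

text \<open>This is thinning: the number of points in \<open>B k\<close> whose mark reaches
  \<open>r k\<close> is Poisson with mean \<open>measure lborel (B k) * (1 - G (r k))\<close>, and
  the event says that there are none. The proof integrates out the marks for fixed points, then
  averages over the points with \<open>poisson_counts_nn_integral\<close>.\<close>

lemma poisson_marks_below:
  fixes B :: "nat \<Rightarrow> real set" and r :: "nat \<Rightarrow> real" and Y :: "nat \<Rightarrow> 'a \<Rightarrow> real"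
  assumes T: "poisson_process_rate1 T"
    and Y: "indep_vars (\<lambda>_. borel) Y UNIV"
    and TY: "indep_var real_seq T real_seq (\<lambda>\<omega> j. Y j \<omega>)"
    and G: "\<And>j s. prob {\<omega> \<in> space M. Y j \<omega> < s} = G s"
    and B: "disjoint_family B" "\<And>k. B k \<in> sets borel" "\<And>k. bounded (B k)" "\<And>k. B k \<subseteq> {0..}"
  shows "prob {\<omega> \<in> space M. \<forall>j. \<forall>k<K. T \<omega> j \<in> B k \<longrightarrow> Y j \<omega> < r k}
    = exp (- (\<Sum>k<K. measure lborel (B k) * (1 - G (r k))))"
proof -
  have T_rv [measurable]: "random_variable real_seq T"
    and Y_rv [measurable]: "random_variable real_seq (\<lambda>\<omega> j. Y j \<omega>)"
    using TY by (auto simp: indep_var_distribution_eq)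
  have [measurable]: "random_variable borel (Y j)" for j
    using Y by (auto simp: indep_vars_def)
  have [measurable]: "B k \<in> sets borel" for k by (rule B)
  have G0: "0 \<le> G s" for s
    using G[of 0 s] by (metis measure_nonneg)
  have G': "prob (Y j -` {..<s} \<inter> space M) = G s" for j s
    unfolding G[of j, symmetric] by (intro arg_cong[where f=prob]) auto
  \<comment> \<open>The event as a set of pairs (points, marks). By independence their joint law is
    a product measure, so Fubini reduces it to slices at fixed points.\<close>
  define A where "A = {z \<in> space (real_seq \<Otimes>\<^sub>M real_seq). \<forall>j. \<forall>k<K. fst z j \<in> B k \<longrightarrow> snd z j < r k}"
  have A [measurable]: "A \<in> sets (real_seq \<Otimes>\<^sub>M real_seq)"
    unfolding A_def by measurable
  interpret DY: prob_space "distr M real_seq (\<lambda>\<omega> j. Y j \<omega>)"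
    by (rule prob_space_distr) measurable
  \<comment> \<open>Divergence of the points makes every bounded cell hold finitely many of them;
    this matters because \<open>card\<close> of an infinite set is 0.\<close>
  have slice: "emeasure (distr M real_seq (\<lambda>\<omega> j. Y j \<omega>)) (Pair (T \<omega>) -` A)
      = (\<Prod>k<K. ennreal (G (r k) ^ card {j. T \<omega> j \<in> B k}))"
    if lim: "filterlim (T \<omega>) at_top sequentially" for \<omega>
  proof -
    have fin: "finite {j. T \<omega> j \<in> B k}" for k
    proof -
      obtain b where b: "\<And>x. x \<in> B k \<Longrightarrow> \<bar>x\<bar> \<le> b"
        using B(3)[of k] by (auto simp: bounded_real)
      obtain n where n: "\<And>j. j \<ge> n \<Longrightarrow> T \<omega> j \<ge> b + 1"
        using lim unfolding filterlim_at_top eventually_sequentially by blast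
      have "{j. T \<omega> j \<in> B k} \<subseteq> {..<n}"
      proof
        fix j assume "j \<in> {j. T \<omega> j \<in> B k}"
        then have "T \<omega> j \<le> b" using b[of "T \<omega> j"] by auto
        then show "j \<in> {..<n}" using n[of j] by (cases "j < n") auto
      qed
      then show ?thesis by (rule finite_subset) simp
    qed
    define J where "J = (\<Union>k<K. {j. T \<omega> j \<in> B k})"
    have finJ: "finite J" unfolding J_def using fin by blast
    \<comment> \<open>The cell of point \<open>j\<close>, unique by disjointness. It is unspecified
      for a point in no cell, but such a \<open>j\<close> is not in \<open>J\<close>.\<close>
    define R where "R j = (THE k. T \<omega> j \<in> B k)" for j
    have R: "R j = k" if "T \<omega> j \<in> B k" for j k
      unfolding R_def using that B(1) by (auto simp: disjoint_family_on_def intro!: the_equality)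
    have "emeasure (distr M real_seq (\<lambda>\<omega> j. Y j \<omega>)) (Pair (T \<omega>) -` A)
        = emeasure M {\<eta> \<in> space M. \<forall>j\<in>J. Y j \<eta> < r (R j)}"
      by (subst emeasure_distr, measurable, intro arg_cong[where f="emeasure M"])
        (auto simp: A_def J_def R space_pair_measure space_PiM)
    also have "\<dots> = ennreal (\<Prod>j\<in>J. G (r (R j)))"
    proof (cases "J = {}")
      case False
      have "prob {\<eta> \<in> space M. \<forall>j\<in>J. Y j \<eta> < r (R j)} = prob (\<Inter>j\<in>J. Y j -` {..<r (R j)} \<inter> space M)"
        using False by (intro arg_cong[where f=prob]) auto
      also have "\<dots> = (\<Prod>j\<in>J. prob (Y j -` {..<r (R j)} \<inter> space M))"
        by (rule indep_varsD[OF Y False finJ]) auto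
      also have "\<dots> = (\<Prod>j\<in>J. G (r (R j)))"
        by (intro prod.cong refl G')
      finally show ?thesis by (simp add: emeasure_eq_measure)
    qed (simp add: emeasure_space_1)
    also have "(\<Prod>j\<in>J. G (r (R j))) = (\<Prod>k<K. \<Prod>j\<in>{j. T \<omega> j \<in> B k}. G (r (R j)))"
      unfolding J_def by (rule prod.UNION_disjoint)
        (use fin B(1) in \<open>auto simp: disjoint_family_on_def\<close>)
    also have "\<dots> = (\<Prod>k<K. G (r k) ^ card {j. T \<omega> j \<in> B k})"
      by (intro prod.cong refl) (simp add: R)
    finally show ?thesis by (simp add: prod_ennreal G0)
  qed
  have "emeasure M {\<omega> \<in> space M. \<forall>j. \<forall>k<K. T \<omega> j \<in> B k \<longrightarrow> Y j \<omega> < r k}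
      = emeasure (distr M (real_seq \<Otimes>\<^sub>M real_seq) (\<lambda>\<omega>. (T \<omega>, \<lambda>j. Y j \<omega>))) A"
    by (subst emeasure_distr, measurable, intro arg_cong[where f="emeasure M"])
      (auto simp: A_def space_pair_measure space_PiM)
  also have "distr M (real_seq \<Otimes>\<^sub>M real_seq) (\<lambda>\<omega>. (T \<omega>, \<lambda>j. Y j \<omega>))
      = distr M real_seq T \<Otimes>\<^sub>M distr M real_seq (\<lambda>\<omega> j. Y j \<omega>)"
    using TY by (simp add: indep_var_distribution_eq)
  also have "emeasure \<dots> A = (\<integral>\<^sup>+t. emeasure (distr M real_seq (\<lambda>\<omega> j. Y j \<omega>)) (Pair t -` A) \<partial>distr M real_seq T)"
    by (rule DY.emeasure_pair_measure_alt) (simp cong: sets_pair_measure_cong add: A)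
  also have "\<dots> = (\<integral>\<^sup>+\<omega>. emeasure (distr M real_seq (\<lambda>\<omega> j. Y j \<omega>)) (Pair (T \<omega>) -` A) \<partial>M)"
  proof (rule nn_integral_distr)
    have "A \<in> sets (real_seq \<Otimes>\<^sub>M distr M real_seq (\<lambda>\<omega> j. Y j \<omega>))"
      by (simp cong: sets_pair_measure_cong add: A)
    from DY.measurable_emeasure_Pair[OF this]
    show "(\<lambda>t. emeasure (distr M real_seq (\<lambda>\<omega> j. Y j \<omega>)) (Pair t -` A)) \<in> borel_measurable (distr M real_seq T)"
      by simp
  qed simp
  also have "\<dots> = (\<integral>\<^sup>+\<omega>. (\<Prod>k<K. ennreal (G (r k) ^ card {j. T \<omega> j \<in> B k})) \<partial>M)"
    by (rule nn_integral_cong_AE) (use T slice in \<open>auto simp: poisson_process_rate1_def\<close>)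
  also have "\<dots> = ennreal (exp (- (\<Sum>k<K. measure lborel (B k) * (1 - G (r k)))))"
    by (rule poisson_counts_nn_integral[OF T B G0])
  finally show ?thesis by (simp add: emeasure_eq_measure)
qed

text \<open>
  Rounding the points down or up to the mesh \<open>x / n\<close>, of which \<open>x\<close> is a multiple, sandwiches the
  event between two events of the preceding kind, whose exponents are geometric sums.
\<close>
lemma poisson_exponential_marks:
  fixes Y :: "nat \<Rightarrow> 'a \<Rightarrow> real"
  assumes T: "poisson_process_rate1 T"
    and Y: "indep_vars (\<lambda>_. borel) Y UNIV"
    and TY: "indep_var real_seq T real_seq (\<lambda>\<omega> j. Y j \<omega>)"
    and G: "\<And>j s. prob {\<omega> \<in> space M. Y j \<omega> < s} = (if s \<le> 0 then 0 else 1 - c * exp (- s))"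
    and c: "0 \<le> c" and x: "0 < x"
  shows "prob {\<omega> \<in> space M. \<forall>j. Y j \<omega> \<le> T \<omega> j - x} = exp (- (x + c))"
proof -
  have [measurable]: "random_variable real_seq T"
    using TY by (auto simp: indep_var_distribution_eq)
  have [measurable]: "random_variable borel (Y j)" for j
    using Y by (auto simp: indep_vars_def)
  define G where "G s = (if s \<le> 0 then 0 else 1 - c * exp (- s))" for s :: real
  define p where "p = prob {\<omega> \<in> space M. \<forall>j. Y j \<omega> \<le> T \<omega> j - x}"
  have bounds: "exp (- (x + x / real n + c)) \<le> p \<and> p \<le> exp (- (x + c * (1 - x / real n)))"
    if n: "0 < n" for n
  proof -
    define \<delta> where "\<delta> = x / real n"
    have \<delta>: "0 < \<delta>" and n\<delta>: "real n * \<delta> = x" using n x by (auto simp: \<delta>_def)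
    define q where "q = exp (- \<delta>)"
    have q: "0 < q" "q < 1" using \<delta> by (auto simp: q_def)
    have q_pow: "exp (- (real m * \<delta>)) = q ^ m" for m
      by (simp add: q_def exp_of_nat_mult[symmetric])
    \<comment> \<open>\<open>\<delta> * S\<close> is the right-endpoint Riemann sum of
      \<open>exp (- t)\<close> over the half-line with mesh \<open>\<delta>\<close>. The integral is
      1, and the sum lies between \<open>1 - \<delta>\<close> and 1.\<close>
    define S where "S = q / (1 - q)"
    have S_sums: "(\<lambda>m. q ^ Suc m) sums S"
      using sums_mult[OF geometric_sums[of q], of q] q by (simp add: S_def)
    have "q * (1 + \<delta>) \<le> 1"
      using exp_ge_add_one_self[of \<delta>] mult_left_mono[of "1 + \<delta>" "exp \<delta>" q] q
      by (simp add: q_def exp_minus)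
    then have S_le: "\<delta> * S \<le> 1"
      using q by (simp add: S_def field_simps)
    have "1 - \<delta> \<le> q"
      using exp_ge_add_one_self[of "- \<delta>"] by (simp add: q_def)
    then have S_ge: "1 - \<delta> \<le> \<delta> * S"
      using q by (simp add: S_def field_simps)
    define B where "B k = {real k * \<delta>..<real (Suc k) * \<delta>}" for k
    have B: "disjoint_family B" "\<And>k. B k \<in> sets borel" "\<And>k. bounded (B k)" "\<And>k. B k \<subseteq> {0..}"
    proof -
      have "B k \<inter> B l = {}" if "k < l" for k l
      proof -
        have "real (Suc k) * \<delta> \<le> real l * \<delta>" using that \<delta> by (intro mult_right_mono) auto
        then show ?thesis by (auto simp: B_def)
      qed
      then show "disjoint_family B"
        unfolding disjoint_family_on_def by (metis inf_commute nat_neq_iff)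
      show "B k \<in> sets borel" "bounded (B k)" for k by (auto simp: B_def)
      show "B k \<subseteq> {0..}" for k
      proof -
        have "0 \<le> real k * \<delta>" using \<delta> by simp
        then show ?thesis by (auto simp: B_def)
      qed
    qed
    have content_B: "measure lborel (B k) = \<delta>" for k
      using \<delta> by (simp add: B_def algebra_simps)
    note below = poisson_marks_below[OF T Y TY G[folded G_def] B, unfolded content_B sum_distrib_left[symmetric]]
    have G_late: "1 - G (real (Suc m) * \<delta>) = c * q ^ Suc m" for m
    proof -
      have "\<not> real (Suc m) * \<delta> \<le> 0" using \<delta> by (simp add: not_le)
      then have "G (real (Suc m) * \<delta>) = 1 - c * exp (- (real (Suc m) * \<delta>))"
        by (simp only: G_def if_False)
      then show ?thesis by (simp only: q_pow)
    qed
    have G_early: "G s = 0" if "s \<le> 0" for s using that by (simp add: G_def)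

    \<comment> \<open>Right ends of cells weaken the requirement. In the first \<open>n\<close>
      cells the threshold is at most 0, so no point may lie there; this contributes
      \<open>n * \<delta> = x\<close> to the exponent. The next \<open>L\<close> cells contribute a
      partial Riemann sum.\<close>
    have upper: "p \<le> exp (- (x + \<delta> * (c * (\<Sum>m<L. q ^ Suc m))))" for L
    proof -
      define A where "A = {\<omega> \<in> space M. \<forall>j. \<forall>k<n + L. T \<omega> j \<in> B k \<longrightarrow> Y j \<omega> < real (Suc k) * \<delta> - x}"
      have [measurable]: "A \<in> events"
        unfolding A_def B_def by measurable
      have "p \<le> prob A"
        unfolding p_def
      proof (rule finite_measure_mono)
        show "{\<omega> \<in> space M. \<forall>j. Y j \<omega> \<le> T \<omega> j - x} \<subseteq> A"
        proof
          fix \<omega> assume *: "\<omega> \<in> {\<omega> \<in> space M. \<forall>j. Y j \<omega> \<le> T \<omega> j - x}"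
          have "Y j \<omega> < real (Suc k) * \<delta> - x" if "T \<omega> j \<in> B k" for j k
          proof -
            have "Y j \<omega> \<le> T \<omega> j - x" using * by blast
            moreover have "T \<omega> j < real (Suc k) * \<delta>" using that unfolding B_def by simp
            ultimately show ?thesis by linarith
          qed
          then show "\<omega> \<in> A" using * by (simp add: A_def)
        qed
      qed measurable
      also have "prob A = exp (- (\<delta> * (\<Sum>k<n + L. 1 - G (real (Suc k) * \<delta> - x))))"
        unfolding A_def by (rule below)
      also have "(\<Sum>k<n + L. 1 - G (real (Suc k) * \<delta> - x)) =
          (\<Sum>k<n. 1 - G (real (Suc k) * \<delta> - x)) + (\<Sum>m<L. 1 - G (real (Suc (n + m)) * \<delta> - x))"
        by (induction L) auto
      also have "(\<Sum>k<n. 1 - G (real (Suc k) * \<delta> - x)) = (\<Sum>k<n. 1)"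
      proof (intro sum.cong refl)
        fix k assume "k \<in> {..<n}"
        then have "real (Suc k) * \<delta> \<le> real n * \<delta>" using \<delta> by (intro mult_right_mono) auto
        then show "1 - G (real (Suc k) * \<delta> - x) = 1" using n\<delta> by (simp add: G_early del: of_nat_Suc)
      qed
      also have "(\<Sum>m<L. 1 - G (real (Suc (n + m)) * \<delta> - x)) = (\<Sum>m<L. c * q ^ Suc m)"
      proof (intro sum.cong refl)
        fix m
        have "real (Suc (n + m)) * \<delta> - x = real (Suc m) * \<delta>" by (simp add: n\<delta>[symmetric] algebra_simps)
        then show "1 - G (real (Suc (n + m)) * \<delta> - x) = c * q ^ Suc m" using G_late by simp
      qed
      finally show ?thesis
        by (simp add: distrib_left n\<delta> mult.commute[of \<delta> "real n"] sum_distrib_left del: power_Suc)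
    qed
    have "(\<lambda>L. exp (- (x + \<delta> * (c * (\<Sum>m<L. q ^ Suc m))))) \<longlonglongrightarrow> exp (- (x + \<delta> * (c * S)))"
      using S_sums unfolding sums_def by (intro tendsto_intros)
    then have "p \<le> exp (- (x + \<delta> * (c * S)))"
      by (rule LIMSEQ_le_const) (use upper in auto)
    also have "\<dots> \<le> exp (- (x + c * (1 - \<delta>)))"
      using mult_left_mono[OF S_ge c] by (simp add: algebra_simps)
    finally have 1: "p \<le> exp (- (x + c * (1 - \<delta>)))" .

    \<comment> \<open>Left ends of cells strengthen the requirement. Now the first
      \<open>n + 1\<close> cells have threshold at most 0, which accounts for the extra
      \<open>\<delta>\<close> in the exponent. Every cell has to be controlled, hence the
      intersection over \<open>K\<close>.\<close>
    define A where "A K = {\<omega> \<in> space M. \<forall>j. \<forall>k<K. T \<omega> j \<in> B k \<longrightarrow> Y j \<omega> < real k * \<delta> - x}" for K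
    have A_ev [measurable]: "A K \<in> events" for K
      unfolding A_def B_def by measurable
    have lower: "exp (- (x + \<delta> + c)) \<le> prob (A K)" for K
    proof -
      \<comment> \<open>Passing to the smaller event with \<open>n + 1 + K\<close> cells leaves
        exactly \<open>K\<close> geometric terms after the empty cells.\<close>
      have "A (n + 1 + K) \<subseteq> A K" by (auto simp: A_def)
      then have mono: "prob (A (n + 1 + K)) \<le> prob (A K)" by (intro finite_measure_mono A_ev)
      have "prob (A (n + 1 + K)) = exp (- (\<delta> * (\<Sum>k<n + 1 + K. 1 - G (real k * \<delta> - x))))"
        unfolding A_def by (rule below)
      also have "(\<Sum>k<n + 1 + K. 1 - G (real k * \<delta> - x)) =
          (\<Sum>k<n + 1. 1 - G (real k * \<delta> - x)) + (\<Sum>m<K. 1 - G (real (n + 1 + m) * \<delta> - x))"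
        by (induction K) auto
      also have "(\<Sum>k<n + 1. 1 - G (real k * \<delta> - x)) = (\<Sum>k<n + 1. 1)"
      proof (intro sum.cong refl)
        fix k assume "k \<in> {..<n + 1}"
        then have "real k * \<delta> \<le> real n * \<delta>" using \<delta> by (intro mult_right_mono) auto
        then show "1 - G (real k * \<delta> - x) = 1" using n\<delta> by (simp add: G_early)
      qed
      also have "(\<Sum>m<K. 1 - G (real (n + 1 + m) * \<delta> - x)) = (\<Sum>m<K. c * q ^ Suc m)"
      proof (intro sum.cong refl)
        fix m
        have "real (n + 1 + m) * \<delta> - x = real (Suc m) * \<delta>" by (simp add: n\<delta>[symmetric] algebra_simps)
        then show "1 - G (real (n + 1 + m) * \<delta> - x) = c * q ^ Suc m" using G_late by simp
      qed
      also have "(\<Sum>k<n + 1. 1) + (\<Sum>m<K. c * q ^ Suc m) = real (n + 1) + c * (\<Sum>m<K. q ^ Suc m)"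
        by (simp add: sum_distrib_left del: power_Suc)
      finally have "exp (- (\<delta> * (real (n + 1) + c * (\<Sum>m<K. q ^ Suc m)))) \<le> prob (A K)"
        using mono by simp
      moreover have "(\<Sum>m<K. q ^ Suc m) \<le> S"
        using S_sums q sum_le_suminf[of "\<lambda>m. q ^ Suc m" "{..<K}"] by (simp add: sums_iff)
      then have "c * (\<delta> * (\<Sum>m<K. q ^ Suc m)) \<le> c * 1"
        using S_le c \<delta> by (intro mult_left_mono) (meson mult_left_mono order_trans less_imp_le)+
      then have "\<delta> * (real (n + 1) + c * (\<Sum>m<K. q ^ Suc m)) \<le> x + \<delta> + c"
        using n\<delta> by (simp add: algebra_simps del: power_Suc)
      ultimately show ?thesis
        by (meson exp_le_cancel_iff neg_le_iff_le order_trans)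
    qed
    have "decseq A" by (auto simp: decseq_def A_def)
    then have "(\<lambda>K. prob (A K)) \<longlonglongrightarrow> prob (\<Inter>K. A K)"
      by (intro finite_Lim_measure_decseq) auto
    then have "exp (- (x + \<delta> + c)) \<le> prob (\<Inter>K. A K)"
      by (rule LIMSEQ_le_const) (use lower in auto)
    also have "\<dots> \<le> p"
      unfolding p_def
    proof (rule finite_measure_mono_AE)
      have "AE \<omega> in M. \<forall>j. 0 \<le> T \<omega> j" using T by (auto simp: poisson_process_rate1_def)
      then show "AE \<omega> in M. \<omega> \<in> (\<Inter>K. A K) \<longrightarrow> \<omega> \<in> {\<omega> \<in> space M. \<forall>j. Y j \<omega> \<le> T \<omega> j - x}"
      proof eventually_elim
        case (elim \<omega>)
        show ?case
        proof
          assume *: "\<omega> \<in> (\<Inter>K. A K)"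
          have "Y j \<omega> \<le> T \<omega> j - x" for j
          proof -
            \<comment> \<open>The floor finds the cell of the point because the point is
              nonnegative. \<open>A (Suc k)\<close> is the first of the events to include the
              condition on cell \<open>k\<close>.\<close>
            define k where "k = nat \<lfloor>T \<omega> j / \<delta>\<rfloor>"
            have "real k = of_int \<lfloor>T \<omega> j / \<delta>\<rfloor>" using elim \<delta> by (simp add: k_def)
            then have "real k \<le> T \<omega> j / \<delta>" "T \<omega> j / \<delta> < real k + 1" by linarith+
            then have "T \<omega> j \<in> B k" using \<delta> by (simp add: B_def field_simps)
            moreover have "\<omega> \<in> A (Suc k)" using * by blast
            ultimately have "Y j \<omega> < real k * \<delta> - x" by (auto simp: A_def)
            then show ?thesis using \<open>T \<omega> j \<in> B k\<close> by (auto simp: B_def)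
          qed
          then show "\<omega> \<in> {\<omega> \<in> space M. \<forall>j. Y j \<omega> \<le> T \<omega> j - x}" using * by (auto simp: A_def)
        qed
      qed
    qed measurable
    finally show ?thesis using 1 by (simp add: \<delta>_def)
  qed
  have lim: "(\<lambda>n. x / real n) \<longlonglongrightarrow> 0" by (rule lim_const_over_n)
  have "(\<lambda>n. exp (- (x + x / real n + c))) \<longlonglongrightarrow> exp (- (x + 0 + c))"
    by (intro tendsto_intros lim)
  then have "exp (- (x + 0 + c)) \<le> p"
    by (rule LIMSEQ_le_const2) (use bounds in \<open>auto intro!: exI[of _ 1]\<close>)
  moreover have "(\<lambda>n. exp (- (x + c * (1 - x / real n)))) \<longlonglongrightarrow> exp (- (x + c * (1 - 0)))"
    by (intro tendsto_intros lim)
  then have "p \<le> exp (- (x + c * (1 - 0)))"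
    by (rule LIMSEQ_le_const) (use bounds in \<open>auto intro!: exI[of _ 1]\<close>)
  ultimately show ?thesis by (simp add: p_def)
qed

end

section \<open>The recursion cut at finite depth\<close>

text \<open>The value at vertex \<open>v\<close> when zeros are put \<open>d\<close> generations
  below it. The infimum makes sense for every \<open>z\<close>, whether or not a minimum is
  attained, since the terms are bounded below by 0.\<close>

primrec truncated :: "nat \<Rightarrow> nat list \<Rightarrow> (nat list \<Rightarrow> nat \<Rightarrow> real) \<Rightarrow> real" where
  "truncated 0 v z = 0"
| "truncated (Suc d) v z = (INF j. max (z v j - truncated d (v @ [j]) z) 0)"

abbreviation subtree :: "nat list \<Rightarrow> nat list set" where
  "subtree v \<equiv> range (\<lambda>w. v @ w)"

lemma subtree_child: "subtree (v @ [j]) \<subseteq> subtree v"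
  by auto

lemma bdd_below_max0: "bdd_below (range (\<lambda>j. max (f j :: real) 0))"
  by (rule bdd_belowI[of _ 0]) auto

lemma truncated_nonneg: "0 \<le> truncated d v z"
  by (cases d) (auto intro!: cINF_greatest)

text \<open>The index set \<open>I\<close> stays free because three choices are used: the subtree of
  one child, the union of the subtrees of all children, and the whole tree.\<close>

lemma truncated_measurable:
  "subtree v \<subseteq> I \<Longrightarrow> truncated d v \<in> borel_measurable (\<Pi>\<^sub>M i\<in>I. real_seq)"
proof (induction d arbitrary: v)
  case 0
  have "truncated 0 v = (\<lambda>_. 0)" by (rule ext) simp
  then show ?case by simp
next
  case (Suc d)
  have step: "truncated (Suc d) v = (\<lambda>z. INF j. max (z v j - truncated d (v @ [j]) z) 0)"
    by (rule ext) simp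
  have "v \<in> subtree v" by (rule range_eqI[of _ _ "[]"]) simp
  then have "v \<in> I" using Suc.prems by blast
  then have coord: "(\<lambda>z. z v j) \<in> borel_measurable (\<Pi>\<^sub>M i\<in>I. real_seq)" for j
    by (rule measurable_compose[OF measurable_component_singleton[of v] measurable_component_singleton[of j]]) auto
  have "truncated d (v @ [j]) \<in> borel_measurable (\<Pi>\<^sub>M i\<in>I. real_seq)" for j
    using Suc.prems subtree_child by (intro Suc.IH) blast
  then show ?case
    using coord unfolding step
    by (intro borel_measurable_cINF borel_measurable_max borel_measurable_diff bdd_below_max0) auto
qed

text \<open>Only the processes in the subtree of \<open>v\<close> enter the value. Disjoint subtrees
  therefore give independent cut variables.\<close>

lemma truncated_restrict:
  "subtree v \<subseteq> I \<Longrightarrow> truncated d v (restrict z I) = truncated d v z"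
proof (induction d arbitrary: v)
  case (Suc d)
  have "v \<in> subtree v" by (rule range_eqI[of _ _ "[]"]) simp
  then have "v \<in> I" using Suc.prems by blast
  moreover have "truncated d (v @ [j]) (restrict z I) = truncated d (v @ [j]) z" for j
    using Suc.prems subtree_child by (intro Suc.IH) blast
  ultimately show ?case by (simp del: restrict_apply add: restrict_apply'[of v])
qed simp

lemma le_truncated_Suc_iff:
  assumes "0 < x"
  shows "x \<le> truncated (Suc d) v z \<longleftrightarrow> (\<forall>j. truncated d (v @ [j]) z \<le> z v j - x)"
proof -
  have "x \<le> truncated (Suc d) v z \<longleftrightarrow> (\<forall>j. x \<le> max (z v j - truncated d (v @ [j]) z) 0)"
    unfolding truncated.simps by (subst le_cINF_iff) (auto simp: bdd_below_max0)
  also have "\<dots> \<longleftrightarrow> (\<forall>j. truncated d (v @ [j]) z \<le> z v j - x)"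
    using assms by (auto simp: le_max_iff_disj le_diff_eq add.commute)
  finally show ?thesis .
qed

text \<open>A pathwise induction: the starting value 0 lies below every solution, and each
  application of the antitone recursion reverses the inequality. An upper bound on
  \<open>x v\<close> uses that it is below all terms, a lower bound that it equals one of
  them.\<close>

lemma truncated_alternates:
  assumes eq: "\<And>i. attained_min (x i) (\<lambda>j. max (z i j - x (i @ [j])) 0)"
  shows "if even d then truncated d v z \<le> x v else x v \<le> truncated d v z"
proof (induction d arbitrary: v)
  case 0
  obtain j where "x v = max (z v j - x (v @ [j])) 0"
    using eq[of v] by (auto simp: attained_min_def)
  then show ?case by simp
next
  case (Suc d)
  show ?case
  proof (cases "even d")
    case True
    have "x v \<le> max (z v j - truncated d (v @ [j]) z) 0" for j
    proof -
      have "x v \<le> max (z v j - x (v @ [j])) 0" using eq[of v] by (auto simp: attained_min_def)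
      also have "\<dots> \<le> max (z v j - truncated d (v @ [j]) z) 0" using Suc.IH[of "v @ [j]"] True by auto
      finally show ?thesis .
    qed
    then show ?thesis using True by (auto intro!: cINF_greatest)
  next
    case False
    obtain j where j: "x v = max (z v j - x (v @ [j])) 0"
      using eq[of v] by (auto simp: attained_min_def)
    have "truncated (Suc d) v z \<le> max (z v j - truncated d (v @ [j]) z) 0"
      unfolding truncated.simps by (rule cINF_lower[OF bdd_below_max0]) simp
    also have "\<dots> \<le> x v" unfolding j using Suc.IH[of "v @ [j]"] False by auto
    finally show ?thesis using False by simp
  qed
qed

section \<open>Tail constants and their limit \<open>lambert_W 1\<close>\<close>

text \<open>The factor of \<open>exp (- x)\<close> in the tail of the variable cut at depth
  \<open>d\<close>.\<close>

definition level :: "nat \<Rightarrow> real" where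
  "level d = ((\<lambda>t. exp (- t)) ^^ d) 0"

lemma level_simps [simp]: "level 0 = 0" "level (Suc d) = exp (- level d)"
  by (simp_all add: level_def)

lemma level_nonneg: "0 \<le> level d"
  by (cases d) auto

text \<open>The map \<open>x * exp x\<close> is strictly increasing on the half-line and takes the
  value 1 there, so the inverse is genuine at 1. Dividing \<open>w * exp w = 1\<close> by
  \<open>exp w\<close> gives the fixed point equation.\<close>

lemma lambert_W_1: "0 < lambert_W 1" "lambert_W 1 < 1" "exp (- lambert_W 1) = lambert_W 1"
proof -
  let ?f = "\<lambda>x::real. x * exp x"
  have inj: "inj_on ?f {0..}"
  proof (rule strict_mono_on_imp_inj_on, rule strict_mono_onI)
    fix x y :: real assume "x \<in> {0..}" "y \<in> {0..}" "x < y"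
    then show "?f x < ?f y" by (intro mult_strict_mono) auto
  qed
  have "\<exists>x\<ge>0. x \<le> 1 \<and> ?f x = 1"
    by (rule IVT') (auto intro!: continuous_intros)
  then obtain x where "0 \<le> x" "?f x = 1" by blast
  then have "1 \<in> ?f ` {0..}" by (metis atLeast_iff imageI)
  from f_the_inv_into_f[OF inj this] the_inv_into_into[OF inj this subset_refl]
  have w: "lambert_W 1 * exp (lambert_W 1) = 1" "0 \<le> lambert_W 1"
    by (auto simp: lambert_W_def)
  then show pos: "0 < lambert_W 1" by (cases "lambert_W 1 = 0") auto
  show "exp (- lambert_W 1) = lambert_W 1" using w(1) by (simp add: exp_minus field_simps)
  then show "lambert_W 1 < 1" using pos by (metis exp_less_one_iff neg_less_0_iff_less)
qed

text \<open>Two steps of \<open>exp (- t)\<close> preserve being below the fixed point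
  \<open>w\<close> and shrink the distance to it by the factor \<open>w < 1\<close>.\<close>

lemma level_even_tendsto: "(\<lambda>k. level (2 * k)) \<longlonglongrightarrow> lambert_W 1"
proof -
  define w where "w = lambert_W 1"
  note w = lambert_W_1[folded w_def]
  have main: "level (2 * k) \<le> w \<and> w - level (2 * k) \<le> w ^ k" for k
  proof (induction k)
    case 0
    then show ?case using w by simp
  next
    case (Suc k)
    define a where "a = level (2 * k)"
    define b where "b = exp (- a)"
    have a: "0 \<le> a" "a \<le> w" "w - a \<le> w ^ k" using Suc level_nonneg by (auto simp: a_def)
    have "w \<le> b" using a w(3) by (metis b_def exp_le_cancel_iff neg_le_iff_le)
    \<comment> \<open>First step, from \<open>a\<close> below \<open>w\<close> to \<open>b\<close>
      above: the tangent inequality bounds the overshoot by \<open>b * (w - a)\<close>, and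
      \<open>b <= 1\<close>.\<close>
    have "1 - (w - a) \<le> exp (- (w - a))" by (metis exp_ge_add_one_self diff_conv_add_uminus)
    then have "b * (1 - (w - a)) \<le> b * exp (- (w - a))" by (intro mult_left_mono) (auto simp: b_def)
    also have "\<dots> = w" using w(3) by (simp add: b_def exp_add[symmetric])
    finally have "b - w \<le> b * (w - a)" by (simp add: algebra_simps)
    also have "\<dots> \<le> 1 * (w - a)" using a by (intro mult_right_mono) (auto simp: b_def)
    finally have ba: "b - w \<le> w ^ k" using a by simp
    \<comment> \<open>Second step, back below \<open>w\<close>: the tangent inequality now starts
      from \<open>w\<close>, which yields the contraction factor \<open>w\<close>.\<close>
    have "1 - (b - w) \<le> exp (- (b - w))" by (metis exp_ge_add_one_self diff_conv_add_uminus)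
    then have "w * (1 - (b - w)) \<le> w * exp (- (b - w))" using w by (intro mult_left_mono) auto
    also have "w * exp (- (b - w)) = exp (- w) * exp (- (b - w))" by (simp add: w(3))
    also have "\<dots> = exp (- b)" by (simp add: exp_add[symmetric])
    finally have "w - exp (- b) \<le> w * (b - w)" by (simp add: algebra_simps)
    also have "\<dots> \<le> w * w ^ k" using ba w by (intro mult_left_mono) auto
    finally have "w - exp (- b) \<le> w ^ Suc k" by simp
    moreover have "exp (- b) \<le> w" using \<open>w \<le> b\<close> w(3) by (metis exp_le_cancel_iff neg_le_iff_le)
    ultimately show ?case by (simp add: a_def b_def)
  qed
  have "(\<lambda>k. w ^ k) \<longlonglongrightarrow> 0" using w by (intro LIMSEQ_power_zero) auto
  then have "(\<lambda>k. w - level (2 * k)) \<longlonglongrightarrow> 0"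
    by (rule tendsto_sandwich[OF _ _ tendsto_const, rotated 2]) (use main in auto)
  from tendsto_diff[OF tendsto_const[of w] this] show ?thesis by (simp add: w_def)
qed

section \<open>Law of the cut variables and endogeny\<close>

context prob_space
begin

text \<open>By induction the cut variables at the children of \<open>v\<close> are i.i.d. marks with
  exponential tail, independent of the points at \<open>v\<close>, so
  \<open>poisson_exponential_marks\<close> yields the next constant. For \<open>x <= 0\<close> the
  event would be the whole space, hence the restriction on \<open>x\<close>.\<close>

lemma truncated_tail:
  assumes P: "\<And>i. poisson_process_rate1 (\<xi> i)" and ind: "indep_vars (\<lambda>_. real_seq) \<xi> UNIV"
    and "0 < x"
  shows "prob {\<omega> \<in> space M. x \<le> truncated d v (\<lambda>i. \<xi> i \<omega>)} = level d * exp (- x)"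
  using \<open>0 < x\<close>
proof (induction d arbitrary: v x)
  case (Suc d)
  define Y where "Y j \<omega> = truncated d (v @ [j]) (\<lambda>i. \<xi> i \<omega>)" for j \<omega>
  define K where "K j = subtree (v @ [j])" for j
  have K: "disjoint_family K" "v \<notin> (\<Union>j. K j)"
    by (auto simp: K_def disjoint_family_on_def)
  have Y_restrict: "Y j \<omega> = truncated d (v @ [j]) (\<lambda>i\<in>I. \<xi> i \<omega>)" if "K j \<subseteq> I" for j \<omega> I
    unfolding Y_def using that by (intro truncated_restrict[symmetric]) (simp add: K_def)
  have meas: "truncated d (v @ [j]) \<in> borel_measurable (\<Pi>\<^sub>M i\<in>I. real_seq)" if "K j \<subseteq> I" for j I
    using that by (intro truncated_measurable) (simp add: K_def)
  have "indep_vars (\<lambda>j. \<Pi>\<^sub>M i\<in>K j. real_seq) (\<lambda>j \<omega>. \<lambda>i\<in>K j. \<xi> i \<omega>) UNIV"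
    by (rule indep_vars_restrict[OF ind]) (use K in auto)
  then have "indep_vars (\<lambda>_. borel) (\<lambda>j \<omega>. truncated d (v @ [j]) (\<lambda>i\<in>K j. \<xi> i \<omega>)) UNIV"
    by (rule indep_vars_compose2) (rule meas[OF subset_refl])
  then have Y_ind: "indep_vars (\<lambda>_. borel) Y UNIV"
    by (simp only: Y_restrict[OF subset_refl, symmetric])
  then have [measurable]: "random_variable borel (Y j)" for j
    by (auto simp: indep_vars_def)
  define L where "L = (\<Union>j. K j)"
  have "indep_var (\<Pi>\<^sub>M i\<in>{v}. real_seq) (\<lambda>\<omega>. \<lambda>i\<in>{v}. \<xi> i \<omega>) (\<Pi>\<^sub>M i\<in>L. real_seq) (\<lambda>\<omega>. \<lambda>i\<in>L. \<xi> i \<omega>)"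
    by (rule indep_var_restrict[OF ind]) (use K in \<open>auto simp: L_def\<close>)
  moreover have "(\<lambda>z. z v) \<in> measurable (\<Pi>\<^sub>M i\<in>{v}. real_seq) real_seq"
    by (rule measurable_component_singleton) simp
  moreover have "(\<lambda>z j. truncated d (v @ [j]) z) \<in> measurable (\<Pi>\<^sub>M i\<in>L. real_seq) real_seq"
    by (rule measurable_PiM_single') (auto simp: L_def intro!: meas)
  ultimately have "indep_var real_seq ((\<lambda>z. z v) \<circ> (\<lambda>\<omega>. \<lambda>i\<in>{v}. \<xi> i \<omega>))
      real_seq ((\<lambda>z j. truncated d (v @ [j]) z) \<circ> (\<lambda>\<omega>. \<lambda>i\<in>L. \<xi> i \<omega>))"
    by (rule indep_var_compose)
  moreover have "(\<lambda>z j. truncated d (v @ [j]) z) \<circ> (\<lambda>\<omega>. \<lambda>i\<in>L. \<xi> i \<omega>) = (\<lambda>\<omega> j. Y j \<omega>)"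
  proof (intro ext)
    fix \<omega> j
    have "K j \<subseteq> L" by (auto simp: L_def)
    from Y_restrict[OF this]
    show "((\<lambda>z j. truncated d (v @ [j]) z) \<circ> (\<lambda>\<omega>. \<lambda>i\<in>L. \<xi> i \<omega>)) \<omega> j = Y j \<omega>" by simp
  qed
  moreover have "(\<lambda>z. z v) \<circ> (\<lambda>\<omega>. \<lambda>i\<in>{v}. \<xi> i \<omega>) = \<xi> v"
    by (auto simp: fun_eq_iff)
  ultimately have TY: "indep_var real_seq (\<xi> v) real_seq (\<lambda>\<omega> j. Y j \<omega>)"
    by (simp only:)
  have G: "prob {\<omega> \<in> space M. Y j \<omega> < s} = (if s \<le> 0 then 0 else 1 - level d * exp (- s))" for j s
  proof (cases "s \<le> 0")
    case True
    have "{\<omega> \<in> space M. Y j \<omega> < s} = {}"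
      using True truncated_nonneg by (force simp: Y_def not_less intro: order_trans)
    then show ?thesis using True by (simp only: measure_empty if_True)
  next
    case False
    have "{\<omega> \<in> space M. Y j \<omega> < s} = space M - {\<omega> \<in> space M. s \<le> Y j \<omega>}" by auto
    also have "prob \<dots> = 1 - prob {\<omega> \<in> space M. s \<le> Y j \<omega>}"
      by (rule prob_compl) measurable
    also have "prob {\<omega> \<in> space M. s \<le> Y j \<omega>} = level d * exp (- s)"
      unfolding Y_def using False by (intro Suc.IH) simp
    finally show ?thesis using False by simp
  qed
  have "prob {\<omega> \<in> space M. x \<le> truncated (Suc d) v (\<lambda>i. \<xi> i \<omega>)}
      = prob {\<omega> \<in> space M. \<forall>j. Y j \<omega> \<le> \<xi> v \<omega> j - x}"
    unfolding le_truncated_Suc_iff[OF Suc.prems] Y_def ..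
  also have "\<dots> = exp (- (x + level d))"
    by (rule poisson_exponential_marks[OF P Y_ind TY G level_nonneg Suc.prems])
  also have "\<dots> = level (Suc d) * exp (- x)"
    by (simp add: exp_add[symmetric])
  finally show ?case .
qed simp

lemma endogenous_edge_cover:
  assumes tail: "\<And>y. 0 \<le> y \<Longrightarrow> 1 - cdf \<mu> y = lambert_W 1 * exp (- y)"
    and rtp: "edge_cover_rtp \<mu> \<xi> X"
  shows "endogenous \<xi> X"
proof -
  have P: "\<And>i. poisson_process_rate1 (\<xi> i)" and ind: "indep_vars (\<lambda>_. real_seq) \<xi> UNIV"
    and X [measurable]: "\<And>i. random_variable borel (X i)" and \<mu>: "\<And>i. distr M borel (X i) = \<mu>"
    and eq: "\<And>i. AE \<omega> in M. attained_min (X i \<omega>) (\<lambda>j. max (\<xi> i \<omega> j - X (i @ [j]) \<omega>) 0)"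
    using rtp by (auto simp: edge_cover_rtp_def)
  define Z where "Z k \<omega> = truncated (2 * k) [] (\<lambda>i. \<xi> i \<omega>)" for k \<omega>
  define S where "S = generated_sigma M real_seq UNIV \<xi>"
  have space_S: "space S = space M" by (simp add: S_def generated_sigma_def)
  have "(\<lambda>\<omega>. \<lambda>i\<in>UNIV. \<xi> i \<omega>) \<in> measurable S (\<Pi>\<^sub>M i\<in>UNIV. real_seq)"
    unfolding S_def generated_sigma_def
    by (rule measurable_vimage_algebra1) (auto simp: space_PiM)
  from measurable_compose[OF this truncated_measurable[of "[]" UNIV]]
  have Z_S: "Z k \<in> borel_measurable S" for k
    by (simp add: Z_def[abs_def] restrict_def)
  have "(\<lambda>\<omega>. \<lambda>i\<in>UNIV. \<xi> i \<omega>) \<in> measurable M (\<Pi>\<^sub>M i\<in>UNIV. real_seq)"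
    using ind by (intro measurable_restrict) (auto simp: indep_vars_def)
  from measurable_compose[OF this truncated_measurable[of "[]" UNIV]]
  have Z_M [measurable]: "random_variable borel (Z k)" for k
    by (simp add: Z_def[abs_def] restrict_def)
  have Z_le: "AE \<omega> in M. \<forall>k. Z k \<omega> \<le> X [] \<omega>"
  proof -
    have "AE \<omega> in M. \<forall>i. attained_min (X i \<omega>) (\<lambda>j. max (\<xi> i \<omega> j - X (i @ [j]) \<omega>) 0)"
      using eq by (simp add: AE_all_countable)
    then show ?thesis
    proof eventually_elim
      case (elim \<omega>)
      show ?case
        using truncated_alternates[of "\<lambda>i. X i \<omega>" "\<lambda>i. \<xi> i \<omega>" "2 * k" "[]" for k] elim
        by (simp add: Z_def)
    qed
  qed
  \<comment> \<open>Almost surely no positive \<open>q\<close> separates all \<open>Z k\<close> from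
    the root variable. The separating event \<open>N\<close> and a tail event of \<open>Z k\<close>
    are disjoint and both lie in \<open>q < X []\<close> up to a null set, so \<open>N\<close> has
    at most the difference of two tails that share a limit.\<close>
  have gap: "AE \<omega> in M. \<not> ((\<forall>k. Z k \<omega> < q) \<and> q < X [] \<omega>)" if q: "0 < q" for q
  proof -
    define N where "N = {\<omega> \<in> space M. (\<forall>k. Z k \<omega> < q) \<and> q < X [] \<omega>}"
    have [measurable]: "N \<in> events" unfolding N_def by measurable
    have XT: "prob {\<omega> \<in> space M. q < X [] \<omega>} = lambert_W 1 * exp (- q)"
    proof -
      have "{\<omega> \<in> space M. q < X [] \<omega>} = space M - {\<omega> \<in> space M. X [] \<omega> \<le> q}" by auto
      also have "prob \<dots> = 1 - prob {\<omega> \<in> space M. X [] \<omega> \<le> q}"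
        by (rule prob_compl) measurable
      also have "prob {\<omega> \<in> space M. X [] \<omega> \<le> q} = cdf \<mu> q"
        unfolding cdf_def \<mu>[of "[]", symmetric]
        by (subst measure_distr) (auto intro!: arg_cong[where f=prob])
      finally show ?thesis using tail q by simp
    qed
    \<comment> \<open>The shift by \<open>inverse (real (Suc m))\<close> turns the weak inequality
      in the tail of \<open>Z k\<close> into the strict \<open>q < X []\<close>.\<close>
    have bound: "prob N \<le> lambert_W 1 * exp (- q) - level (2 * k) * exp (- (q + inverse (real (Suc m))))" for k m
    proof -
      let ?q = "q + inverse (real (Suc m))"
      have "q < ?q" by simp
      have "prob (N \<union> {\<omega> \<in> space M. ?q \<le> Z k \<omega>}) \<le> prob {\<omega> \<in> space M. q < X [] \<omega>}"
      proof (rule finite_measure_mono_AE)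
        from Z_le show "AE \<omega> in M. \<omega> \<in> N \<union> {\<omega> \<in> space M. ?q \<le> Z k \<omega>} \<longrightarrow> \<omega> \<in> {\<omega> \<in> space M. q < X [] \<omega>}"
        proof eventually_elim
          case (elim \<omega>)
          have "q < X [] \<omega>" if "?q \<le> Z k \<omega>"
            using \<open>q < ?q\<close> that elim[rule_format, of k] by linarith
          then show ?case by (auto simp: N_def)
        qed
      qed measurable
      moreover have "prob (N \<union> {\<omega> \<in> space M. ?q \<le> Z k \<omega>}) = prob N + prob {\<omega> \<in> space M. ?q \<le> Z k \<omega>}"
      proof (rule finite_measure_Union)
        have False if "\<omega> \<in> N" "?q \<le> Z k \<omega>" for \<omega>
        proof -
          have "Z k \<omega> < q" using that(1) by (auto simp: N_def)
          then show False using that(2) \<open>q < ?q\<close> by linarith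
        qed
        then show "N \<inter> {\<omega> \<in> space M. ?q \<le> Z k \<omega>} = {}" by blast
      qed measurable
      moreover have "prob {\<omega> \<in> space M. ?q \<le> Z k \<omega>} = level (2 * k) * exp (- ?q)"
        unfolding Z_def using q by (intro truncated_tail[OF P ind]) (simp add: add_pos_pos)
      ultimately show ?thesis using XT by simp
    qed
    \<comment> \<open>Taking \<open>m = k\<close> lets the tail constant converge and the shift
      vanish in one limit, whose value is 0.\<close>
    have "(\<lambda>k. lambert_W 1 * exp (- q) - level (2 * k) * exp (- (q + inverse (real (Suc k)))))
        \<longlonglongrightarrow> lambert_W 1 * exp (- q) - lambert_W 1 * exp (- (q + 0))"
      by (intro tendsto_intros level_even_tendsto LIMSEQ_inverse_real_of_nat)
    then have "prob N \<le> lambert_W 1 * exp (- q) - lambert_W 1 * exp (- (q + 0))"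
      by (rule LIMSEQ_le_const) (use bound in auto)
    then have "prob N = 0" by (simp add: measure_le_0_iff)
    then have "AE \<omega> in M. \<omega> \<notin> N" by (subst (asm) prob_eq_0) auto
    then show ?thesis by (rule AE_mp) (auto simp: N_def)
  qed
  \<comment> \<open>In the extended reals the supremum exists and is measurable for every outcome,
    even if the \<open>Z k\<close> are unbounded; almost surely it is finite and equals the root
    variable.\<close>
  define Y where "Y \<omega> = real_of_ereal (SUP k. ereal (Z k \<omega>))" for \<omega>
  have "Y \<in> borel_measurable S"
    unfolding Y_def[abs_def] using Z_S by measurable
  moreover have "AE \<omega> in M. X [] \<omega> = Y \<omega>"
  proof -
    \<comment> \<open>Rational thresholds keep the exceptional sets countable, and one would fit
      into any gap between the supremum and the root variable.\<close>
    have "AE \<omega> in M. \<forall>q::rat. 0 < q \<longrightarrow> \<not> ((\<forall>k. Z k \<omega> < of_rat q) \<and> of_rat q < X [] \<omega>)"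
      unfolding AE_all_countable using gap by (auto simp: AE_conj_iff)
    with Z_le show ?thesis
    proof eventually_elim
      case (elim \<omega>)
      have "(SUP k. ereal (Z k \<omega>)) = ereal (X [] \<omega>)"
      proof (rule antisym)
        show "(SUP k. ereal (Z k \<omega>)) \<le> ereal (X [] \<omega>)"
          using elim by (intro SUP_least) auto
        show "ereal (X [] \<omega>) \<le> (SUP k. ereal (Z k \<omega>))"
        proof (rule ccontr)
          assume "\<not> ereal (X [] \<omega>) \<le> (SUP k. ereal (Z k \<omega>))"
          then have "(SUP k. ereal (Z k \<omega>)) < ereal (X [] \<omega>)" by simp
          then obtain r where r: "(SUP k. ereal (Z k \<omega>)) < ereal r" "ereal r < ereal (X [] \<omega>)"
            using ereal_dense2 by blast
          obtain q where q: "r < of_rat q" "of_rat q < X [] \<omega>"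
            using of_rat_dense r(2) by auto
          have Zq: "Z k \<omega> < of_rat q" for k
          proof -
            have "ereal (Z k \<omega>) \<le> (SUP k. ereal (Z k \<omega>))" by (rule SUP_upper) simp
            then have "ereal (Z k \<omega>) < ereal r" using r(1) by (rule le_less_trans)
            then show ?thesis using q by simp
          qed
          \<comment> \<open>The separating rational exceeds a nonnegative cut variable, so it is
            positive, as \<open>gap\<close> demands.\<close>
          have "0 \<le> Z 0 \<omega>" unfolding Z_def by (rule truncated_nonneg)
          then have "(0::real) < of_rat q" using Zq[of 0] by linarith
          then have "0 < q" by simp
          then show False using elim Zq q by blast
        qed
      qed
      then show ?case by (simp add: Y_def)
    qed
  qed
  ultimately show ?thesis by (auto simp: endogenous_def S_def)
qed

end

theorem theorem12:
  fixes M :: "'a measure" and \<mu> :: "real measure"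
    and \<xi> :: "nat list \<Rightarrow> 'a \<Rightarrow> nat \<Rightarrow> real" and X :: "nat list \<Rightarrow> 'a \<Rightarrow> real"
  assumes "real_distribution \<mu>"
    and "\<And>y. 1 - cdf \<mu> y = (if y \<ge> 0 then lambert_W 1 * exp (- y) else 1)"
    and "prob_space M"
    and "prob_space.edge_cover_rtp M \<mu> \<xi> X"
  shows "prob_space.endogenous M \<xi> X"
  by (rule prob_space.endogenous_edge_cover[OF assms(3) _ assms(4)]) (simp add: assms(2))

end
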